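(* For every positive integer $n$, $f(2n)\leq 6$; that is, for every choice of pairwise coprime integers $a_1,\dots,a_6$, every matrix $A\in M_{2n}(\mathbb{Z})$ can be written as $A=\sum_{i=1}^{6}a_iX_i^2$ with $X_1,\dots,X_6\in M_{2n}(\mathbb{Z})$.
   Context: A form $\sum_{i=1}^{m}a_iX_i^2$ with integer coefficients is called universal over $M_n(\mathbb{Z})$ if for every $A\in M_n(\mathbb{Z})$ there exist $X_1,\dots,X_m\in M_n(\mathbb{Z})$ with $A=\sum_{i=1}^{m}a_iX_i^2$. For an integer $n\geq 2$, $f(n)$ denotes the smallest positive integer $m$ such that for every choice of pairwise coprime integers $a_1,\dots,a_m$, the form $\sum_{i=1}^{m}a_iX_i^2$ is universal over $M_n(\mathbb{Z})$. *)

theory Defs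
  imports "Jordan_Normal_Form.Matrix"
begin

definition diag_form :: "nat \<Rightarrow> nat \<Rightarrow> (nat \<Rightarrow> int) \<Rightarrow> (nat \<Rightarrow> int mat) \<Rightarrow> int mat" where
  "diag_form n m a X =
     finsum (ring_mat TYPE(int) n ()) (\<lambda>i. a i \<cdot>\<^sub>m (X i ^\<^sub>m 2)) {1..m}"

definition universal_form :: "nat \<Rightarrow> nat \<Rightarrow> (nat \<Rightarrow> int) \<Rightarrow> bool" where
  "universal_form n m a \<longleftrightarrow>
     (\<forall>A \<in> carrier_mat n n. \<exists>X. (\<forall>i \<in> {1..m}. X i \<in> carrier_mat n n) \<and> A = diag_form n m a X)"

definition pairwise_coprime :: "nat \<Rightarrow> (nat \<Rightarrow> int) \<Rightarrow> bool" where
  "pairwise_coprime m a \<longleftrightarrow>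
     (\<forall>i \<in> {1..m}. \<forall>j \<in> {1..m}. i \<noteq> j \<longrightarrow> coprime (a i) (a j))"

(* If no m qualified, LEAST would return an unspecified number; a bound on min_universal n is
   therefore only informative together with the existence of a qualifying m. *)
definition min_universal :: "nat \<Rightarrow> nat" where
  "min_universal n =
     (LEAST m. 0 < m \<and> (\<forall>a. pairwise_coprime m a \<longrightarrow> universal_form n m a))"

end

theory Submission
  imports Defs "HOL-Combinatorics.Transposition"
begin

text \<open>Write \<open>A\<close> in blocks of size \<open>n\<close>. If three blocks of a block matrix are fixed and its lower left block
  varies, then all blocks of its square depend affinely on the varying block. With suitable fixed
  blocks in the six summands, the upper right block of \<open>A\<close> can be matched first. The lower left
  block is matched by two summands and leaves a parameter free. For the diagonal blocks, the reachable
  pairs form a lattice inside the pairs of equal trace. It contains, with the coprime factors \<open>a1\<close>, \<open>a5\<close> and \<open>a6\<close>,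
  the pairs \<open>(Y, Y)\<close>, \<open>(N Y, Y N)\<close> and \<open>(e Y, Y e)\<close>, which generate all pairs of equal trace; here \<open>N\<close> is
  the nilpotent shift and \<open>e\<close> is a matrix unit. The summand of \<open>a4\<close>, whose upper right block is
  congruent to \<open>a5 a6 + a1 a6 N + a1 a5 e\<close> modulo \<open>a1 a5 a6\<close>, takes over for each of these
  generators at the primes that divide its factor, so the lattice is everything. The difference of
  the traces of the diagonal blocks of \<open>A\<close> is matched separately, by a block diagonal summand and
  by a scalar shift.\<close>

section \<open>The trace, the nilpotent shift and the corner matrix unit\<close>

definition mat_trace :: "int mat \<Rightarrow> int" where
  "mat_trace A = (\<Sum>i<dim_row A. A $$ (i, i))"

definition shift_mat :: "nat \<Rightarrow> int mat" where
  "shift_mat n = mat n n (\<lambda>(i, j). if j = Suc i then 1 else 0)"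

text \<open>The matrix unit sits in the last diagonal place because solving a commutator equation
  with the shift row by row leaves exactly the last row open.\<close>

definition corner_mat :: "nat \<Rightarrow> int mat" where
  "corner_mat n = mat n n (\<lambda>(i, j). if Suc i = n \<and> j = i then 1 else 0)"

lemma shift_mat_carrier [simp]: "shift_mat n \<in> carrier_mat n n"
  by (simp add: shift_mat_def)

lemma corner_mat_carrier [simp]: "corner_mat n \<in> carrier_mat n n"
  by (simp add: corner_mat_def)

lemma shift_corner_dims [simp]:
  "dim_row (shift_mat n) = n" "dim_col (shift_mat n) = n"
  "dim_row (corner_mat n) = n" "dim_col (corner_mat n) = n"
  by (simp_all add: shift_mat_def corner_mat_def)

lemma mat_trace_add:
  assumes "A \<in> carrier_mat n n" "B \<in> carrier_mat n n"
  shows "mat_trace (A + B) = mat_trace A + mat_trace B"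
  using assms by (simp add: mat_trace_def sum.distrib)

lemma mat_trace_minus:
  assumes "A \<in> carrier_mat n n" "B \<in> carrier_mat n n"
  shows "mat_trace (A - B) = mat_trace A - mat_trace B"
  using assms by (simp add: mat_trace_def sum_subtractf)

lemma mat_trace_smult:
  assumes "A \<in> carrier_mat n n"
  shows "mat_trace (c \<cdot>\<^sub>m A) = c * mat_trace A"
  using assms by (simp add: mat_trace_def sum_distrib_left)

lemma mat_trace_one: "mat_trace (1\<^sub>m n) = int n"
  by (simp add: mat_trace_def)

lemma index_mult_mat_sum:
  assumes "A \<in> carrier_mat n n" "B \<in> carrier_mat n n" "i < n" "j < n"
  shows "(A * B) $$ (i, j) = (\<Sum>k<n. A $$ (i, k) * B $$ (k, j))"
  using assms by (simp add: scalar_prod_def atLeast0LessThan)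

lemma mat_trace_comm:
  assumes "A \<in> carrier_mat n n" "B \<in> carrier_mat n n"
  shows "mat_trace (A * B) = mat_trace (B * A)"
proof -
  have "mat_trace (A * B) = (\<Sum>i<n. \<Sum>k<n. A $$ (i, k) * B $$ (k, i))"
    using assms by (simp add: mat_trace_def index_mult_mat_sum del: index_mult_mat(1))
  also have "\<dots> = (\<Sum>k<n. \<Sum>i<n. B $$ (k, i) * A $$ (i, k))"
    by (subst sum.swap) (simp add: mult.commute)
  also have "\<dots> = mat_trace (B * A)"
    using assms by (simp add: mat_trace_def index_mult_mat_sum del: index_mult_mat(1))
  finally show ?thesis .
qed

lemma shift_mult_index:
  assumes "Y \<in> carrier_mat n n" "i < n" "j < n"
  shows "(shift_mat n * Y) $$ (i, j) = (if Suc i < n then Y $$ (Suc i, j) else 0)"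
proof -
  have "(shift_mat n * Y) $$ (i, j) = (\<Sum>k<n. if k = Suc i then Y $$ (k, j) else 0)"
    unfolding index_mult_mat_sum[OF shift_mat_carrier assms]
    using assms by (intro sum.cong) (auto simp: shift_mat_def)
  then show ?thesis by simp
qed

lemma mult_shift_index:
  assumes "Y \<in> carrier_mat n n" "i < n" "j < n"
  shows "(Y * shift_mat n) $$ (i, j) = (case j of 0 \<Rightarrow> 0 | Suc k \<Rightarrow> Y $$ (i, k))"
proof -
  have "(Y * shift_mat n) $$ (i, j) = (\<Sum>k<n. if j = Suc k then Y $$ (i, k) else 0)"
    unfolding index_mult_mat_sum[OF assms(1) shift_mat_carrier assms(2,3)]
    using assms by (intro sum.cong) (auto simp: shift_mat_def)
  then show ?thesis using assms by (cases j) simp_all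
qed

lemma corner_mult_index:
  assumes "Y \<in> carrier_mat n n" "i < n" "j < n"
  shows "(corner_mat n * Y) $$ (i, j) = (if Suc i = n then Y $$ (i, j) else 0)"
proof -
  have "(corner_mat n * Y) $$ (i, j) = (\<Sum>k<n. if k = i then (if Suc i = n then Y $$ (i, j) else 0) else 0)"
    unfolding index_mult_mat_sum[OF corner_mat_carrier assms]
    using assms by (intro sum.cong) (auto simp: corner_mat_def)
  then show ?thesis using assms by simp
qed

lemma mult_corner_index:
  assumes "Y \<in> carrier_mat n n" "i < n" "j < n"
  shows "(Y * corner_mat n) $$ (i, j) = (if Suc j = n then Y $$ (i, j) else 0)"
proof -
  have "(Y * corner_mat n) $$ (i, j) = (\<Sum>k<n. if k = j then (if Suc j = n then Y $$ (i, j) else 0) else 0)"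
    unfolding index_mult_mat_sum[OF assms(1) corner_mat_carrier assms(2,3)]
    using assms by (intro sum.cong) (auto simp: corner_mat_def)
  then show ?thesis using assms by simp
qed

section \<open>Two auxiliary equations: a shift commutator and a trace equation\<close>

primrec shift_commutator_sol :: "(nat \<Rightarrow> nat \<Rightarrow> int) \<Rightarrow> nat \<Rightarrow> nat \<Rightarrow> int" where
  "shift_commutator_sol E 0 j = 0"
| "shift_commutator_sol E (Suc i) j =
     E i j + (case j of 0 \<Rightarrow> 0 | Suc k \<Rightarrow> shift_commutator_sol E i k)"

text \<open>The recursion above solves every row of \<open>N Y - Y N = S - U\<close> but the last one, for the
  shift \<open>N\<close>; the last row is a commutator with the corner matrix unit, because the trace forces
  its last entry to vanish.\<close>

lemma odd_coprime_trace_equation: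
  fixes a b c :: int
  assumes "coprime a b" "odd a" "odd b"
  obtains u w x where "c = a * (u\<^sup>2 - w\<^sup>2) + 2 * b * x"
proof (cases "even c")
  case True
  then obtain c' where c': "c = 2 * c'" by blast
  have "coprime (2 * a) b" using assms by simp
  then obtain r s where "r * (2 * a) + s * b = 1"
    using bezout_int[of "2 * a" b] by (metis coprime_iff_gcd_eq_1)
  then have "c' = c' * (r * (2 * a) + s * b)" by simp
  then have "c = a * ((c' * r + 1)\<^sup>2 - (c' * r - 1)\<^sup>2) + 2 * b * (c' * s)"
    unfolding c' by (simp add: power2_eq_square algebra_simps)
  then show ?thesis using that by blast
next
  case False
  then have "even (c - a)" using assms(2) by simp
  then obtain c' where "c - a = 2 * c'" by blast
  then have c': "c = 2 * c' + a" by simp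
  obtain r s where "r * a + s * b = 1"
    using bezout_int[of a b] assms(1) by (metis coprime_iff_gcd_eq_1)
  then have "c' = c' * (r * a + s * b)" by simp
  then have "c = a * ((c' * r + 1)\<^sup>2 - (c' * r)\<^sup>2) + 2 * b * (c' * s)"
    unfolding c' by (simp add: power2_eq_square algebra_simps)
  then show ?thesis using that by blast
qed

section \<open>Square matrices of a fixed size: equal traces and a unimodular matrix\<close>

context
  fixes n :: nat
begin

lemma square_mult_carrier:
  "A \<in> carrier_mat n n \<Longrightarrow> B \<in> carrier_mat n n \<Longrightarrow> A * B \<in> carrier_mat n n"
  by (rule mult_carrier_mat)

lemma square_minus_carrier:
  "B \<in> carrier_mat n n \<Longrightarrow> A - B \<in> carrier_mat n n"
  by (rule minus_carrier_mat)

lemmas square_carrier = square_mult_carrier square_minus_carrier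

text \<open>With all dimensions set to \<open>n\<close>, the simplifier can discharge the carrier
  conditions and expand into right-nested products. Matrix identities then become ring identities
  between entries; deleting \<open>index_mult_mat(1)\<close> keeps the entries of products
  opaque.\<close>

lemmas square_ring = square_carrier
  add_mult_distrib_mat[of _ n n _ _ n] mult_add_distrib_mat[of _ n n _ n]
  minus_mult_distrib_mat[of _ n n _ _ n] mult_minus_distrib_mat[of _ n n _ n]
  mult_smult_distrib[of _ n n _ n] mult_smult_assoc_mat[of _ n n _ n]
  assoc_mult_mat[of _ n n _ n _ n]

lemmas square_trace = mat_trace_add[of _ n] mat_trace_minus[of _ n] mat_trace_smult[of _ n]
  mat_trace_one[of n]

text \<open>\<open>S - U\<close> has trace zero and is therefore a sum of a commutator with the
  shift and a commutator with the corner unit; \<open>Y0\<close> takes the part common to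
  \<open>S\<close> and \<open>U\<close>.\<close>

lemma equal_trace_decomposition:
  assumes S: "S \<in> carrier_mat n n" and U: "U \<in> carrier_mat n n"
    and tr: "mat_trace S = mat_trace U"
  shows "\<exists>Y0 \<in> carrier_mat n n. \<exists>Y1 \<in> carrier_mat n n. \<exists>Y2 \<in> carrier_mat n n.
    S = Y0 + shift_mat n * Y1 + corner_mat n * Y2 \<and> U = Y0 + Y1 * shift_mat n + Y2 * corner_mat n"
proof -
  define E where "E = S - U"
  define Y where "Y = mat n n (\<lambda>(i, j). shift_commutator_sol (\<lambda>i j. E $$ (i, j)) i j)"
  have E: "E \<in> carrier_mat n n" using U by (simp add: E_def square_carrier)
  have Y: "Y \<in> carrier_mat n n" by (simp add: Y_def)
  define G where "G = E - (shift_mat n * Y - Y * shift_mat n)"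
  have NY: "shift_mat n * Y \<in> carrier_mat n n" and YN: "Y * shift_mat n \<in> carrier_mat n n"
    using Y by (simp_all add: square_carrier)
  have G: "G \<in> carrier_mat n n"
    unfolding G_def using E NY YN by (simp add: square_carrier)
  have G0: "G $$ (i, j) = 0" if "Suc i < n" "j < n" for i j
    using that E Y NY YN
    by (auto simp: G_def shift_mult_index mult_shift_index Y_def split: nat.split
        simp del: index_mult_mat(1))
  have "mat_trace G = 0"
    using E NY YN tr S U Y unfolding G_def
    by (simp add: square_trace square_carrier E_def mat_trace_comm[of Y n])
  \<comment> \<open>Only the last row of \<open>G\<close> can be nonzero, so its trace is its last
    diagonal entry.\<close>
  then have Gn: "G $$ (i, i) = 0" if "Suc i = n" for i
  proof -
    have "mat_trace G = (\<Sum>k<Suc i. G $$ (k, k))" using G that by (simp only: mat_trace_def carrier_matD)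
    also have "\<dots> = (\<Sum>k<i. G $$ (k, k)) + G $$ (i, i)" by simp
    also have "(\<Sum>k<i. G $$ (k, k)) = 0" using that by (intro sum.neutral) (auto intro: G0)
    finally show ?thesis using \<open>mat_trace G = 0\<close> by simp
  qed
  \<comment> \<open>A matrix supported in the last row is fixed by the corner unit from the left,
    and the vanishing last entry makes it killed from the right. Hence \<open>G\<close> is its own
    commutator with the corner unit.\<close>
  have eG: "corner_mat n * G = G"
    using G G0 by (intro eq_matI) (auto simp: corner_mult_index simp del: index_mult_mat(1))
  have Ge: "G * corner_mat n = 0\<^sub>m n n"
  proof (intro eq_matI, goal_cases)
    case (1 i j)
    then have "G $$ (i, j) = 0" if "Suc j = n"
      using G0[of i j] Gn[of i] that by (cases "Suc i = n") auto
    with 1 G show ?case by (auto simp: mult_corner_index simp del: index_mult_mat(1))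
  qed (use G in auto)
  have S_eq: "S = (U - Y * shift_mat n) + shift_mat n * Y + corner_mat n * G"
    using S U Y G NY YN unfolding eG
    by (intro eq_matI) (auto simp: G_def E_def simp del: index_mult_mat(1))
  have U_eq: "U = (U - Y * shift_mat n) + Y * shift_mat n + G * corner_mat n"
    using U Y G YN unfolding Ge by (intro eq_matI) (auto simp del: index_mult_mat(1))
  have "U - Y * shift_mat n \<in> carrier_mat n n" using YN by (rule square_minus_carrier)
  then show ?thesis using S_eq U_eq Y G by blast
qed

text \<open>\<open>V\<close> will be the sum of the two diagonal blocks of \<open>X3\<close>. Its
  invertibility leaves the off-diagonal blocks of that square free, and its trace 1 makes a scalar
  shift by \<open>x\<close> change the trace difference by \<open>2 * x\<close>. It is a product of
  two elementary matrices, of trace \<open>n + mat_trace (X * Y)\<close> with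
  \<open>mat_trace (X * Y) = 1 - n\<close>; for \<open>n = 1\<close> both \<open>X\<close> and
  \<open>Y\<close> vanish.\<close>

lemma unimodular_trace_one:
  assumes "n > 0"
  obtains V V' :: "int mat" where "V \<in> carrier_mat n n" "V' \<in> carrier_mat n n"
    "V * V' = 1\<^sub>m n" "V' * V = 1\<^sub>m n" "mat_trace V = 1"
proof -
  define X :: "int mat" where "X = mat n n (\<lambda>(i, j). if i = 0 \<and> j = 1 then 1 - int n else 0)"
  define Y :: "int mat" where "Y = mat n n (\<lambda>(i, j). if i = 1 \<and> j = 0 then 1 else 0)"
  have X: "X \<in> carrier_mat n n" and Y: "Y \<in> carrier_mat n n" by (auto simp: X_def Y_def)
  have XX: "X * X = 0\<^sub>m n n"
  proof (intro eq_matI, goal_cases)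
    case (1 i j)
    then have "(X * X) $$ (i, j) = (\<Sum>k<n. X $$ (i, k) * X $$ (k, j))"
      by (intro index_mult_mat_sum[OF X X]) auto
    also have "\<dots> = 0" using 1 by (intro sum.neutral) (auto simp: X_def)
    finally show ?case using 1 by simp
  qed (use X in auto)
  have YY: "Y * Y = 0\<^sub>m n n"
  proof (intro eq_matI, goal_cases)
    case (1 i j)
    then have "(Y * Y) $$ (i, j) = (\<Sum>k<n. Y $$ (i, k) * Y $$ (k, j))"
      by (intro index_mult_mat_sum[OF Y Y]) auto
    also have "\<dots> = 0" using 1 by (intro sum.neutral) (auto simp: Y_def)
    finally show ?case using 1 by simp
  qed (use Y in auto)
  have inv: "(1\<^sub>m n + Z) * (1\<^sub>m n - Z) = 1\<^sub>m n" "(1\<^sub>m n - Z) * (1\<^sub>m n + Z) = 1\<^sub>m n"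
    if Z: "Z \<in> carrier_mat n n" "Z * Z = 0\<^sub>m n n" for Z :: "int mat"
  proof -
    show "(1\<^sub>m n + Z) * (1\<^sub>m n - Z) = 1\<^sub>m n"
      using Z by (simp add: square_ring)
        (intro eq_matI, auto)
    show "(1\<^sub>m n - Z) * (1\<^sub>m n + Z) = 1\<^sub>m n"
      using Z by (simp add: square_ring)
        (intro eq_matI, auto)
  qed
  let ?V = "(1\<^sub>m n + X) * (1\<^sub>m n + Y)" and ?V' = "(1\<^sub>m n - Y) * (1\<^sub>m n - X)"
  have cancel: "(A * B) * (B' * A') = 1\<^sub>m n"
    if "A \<in> carrier_mat n n" "B \<in> carrier_mat n n" "A' \<in> carrier_mat n n" "B' \<in> carrier_mat n n"
      "B * B' = 1\<^sub>m n" "A * A' = 1\<^sub>m n" for A B A' B' :: "int mat"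
  proof -
    have "(A * B) * (B' * A') = A * ((B * B') * A')"
      using that(1-4) by (simp add: square_ring)
    then show ?thesis using that by simp
  qed
  have car: "1\<^sub>m n + X \<in> carrier_mat n n" "1\<^sub>m n + Y \<in> carrier_mat n n"
    "1\<^sub>m n - X \<in> carrier_mat n n" "1\<^sub>m n - Y \<in> carrier_mat n n"
    using X Y by (simp_all add: square_carrier)
  have "mat_trace (X * Y) = 1 - int n"
  proof -
    have "mat_trace (X * Y) = (\<Sum>i<n. \<Sum>k<n. X $$ (i, k) * Y $$ (k, i))"
      using X Y by (simp add: mat_trace_def index_mult_mat_sum del: index_mult_mat(1))
    also have "\<dots> = (\<Sum>i<n. \<Sum>k<n. if k = 1 then (if i = 0 then 1 - int n else 0) else 0)"
      by (intro sum.cong) (auto simp: X_def Y_def)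
    also have "\<dots> = 1 - int n" using assms by (cases "n = 1") auto
    finally show ?thesis .
  qed
  moreover have "mat_trace X = 0" "mat_trace Y = 0"
    by (auto simp: mat_trace_def X_def Y_def intro!: sum.neutral)
  ultimately have "mat_trace ?V = 1"
    using X Y car by (simp add: square_ring square_trace)
  then show ?thesis
    using that[of ?V ?V'] car cancel inv[OF X XX] inv[OF Y YY]
    by (simp add: square_carrier)
qed


section \<open>The lattice of reachable pairs is everything of equal trace\<close>

text \<open>The generators with factors \<open>a1\<close>, \<open>a5\<close>, \<open>a6\<close>
  already give \<open>t\<close> times every pair of equal trace. This removes the terms divisible by
  \<open>t\<close> from \<open>PW\<close>, and what remains is a combination of the three generators
  without those factors. Isolating one generator at a time gives it a multiplier coprime to the
  factor it had, and Bezout removes both.\<close>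

lemma equal_trace_lattice:
  fixes P :: "int mat \<Rightarrow> int mat \<Rightarrow> bool" and a1 a5 a6 b :: int
  defines "t \<equiv> a1 * a5 * a6"
  assumes add: "\<And>S U S' U'. \<lbrakk>S \<in> carrier_mat n n; U \<in> carrier_mat n n;
        S' \<in> carrier_mat n n; U' \<in> carrier_mat n n; P S U; P S' U'\<rbrakk> \<Longrightarrow> P (S + S') (U + U')"
    and smult: "\<And>c S U. \<lbrakk>S \<in> carrier_mat n n; U \<in> carrier_mat n n; P S U\<rbrakk> \<Longrightarrow> P (c \<cdot>\<^sub>m S) (c \<cdot>\<^sub>m U)"
    and P1: "\<And>Y. Y \<in> carrier_mat n n \<Longrightarrow> P (a1 \<cdot>\<^sub>m Y) (a1 \<cdot>\<^sub>m Y)"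
    and P5: "\<And>Y. Y \<in> carrier_mat n n \<Longrightarrow> P (a5 \<cdot>\<^sub>m (shift_mat n * Y)) (a5 \<cdot>\<^sub>m (Y * shift_mat n))"
    and P6: "\<And>Y. Y \<in> carrier_mat n n \<Longrightarrow> P (a6 \<cdot>\<^sub>m (corner_mat n * Y)) (a6 \<cdot>\<^sub>m (Y * corner_mat n))"
    and PW: "\<And>W. W \<in> carrier_mat n n \<Longrightarrow>
        P (b \<cdot>\<^sub>m (q * W - t \<cdot>\<^sub>m (g * (h * W)))) (b \<cdot>\<^sub>m (W * q - t \<cdot>\<^sub>m (h * W * g)))"
    and q: "q = (a5 * a6) \<cdot>\<^sub>m 1\<^sub>m n + (a1 * a6) \<cdot>\<^sub>m shift_mat n + (a1 * a5) \<cdot>\<^sub>m corner_mat n + t \<cdot>\<^sub>m K"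
    and car: "K \<in> carrier_mat n n" "g \<in> carrier_mat n n" "h \<in> carrier_mat n n"
    and cop: "coprime a1 a5" "coprime a1 a6" "coprime a5 a6" "coprime a1 b" "coprime a5 b" "coprime a6 b"
    and S: "S \<in> carrier_mat n n" and U: "U \<in> carrier_mat n n" and tr: "mat_trace S = mat_trace U"
  shows "P S U"
proof -
  let ?N = "shift_mat n" and ?e = "corner_mat n"
  have diff: "P (S - S') (U - U')"
    if "S \<in> carrier_mat n n" "U \<in> carrier_mat n n" "S' \<in> carrier_mat n n" "U' \<in> carrier_mat n n"
      "P S U" "P S' U'" for S U S' U'
  proof -
    have "P (S + (-1) \<cdot>\<^sub>m S') (U + (-1) \<cdot>\<^sub>m U')" using that by (intro add smult) auto
    moreover have "S + (-1) \<cdot>\<^sub>m S' = S - S'" "U + (-1) \<cdot>\<^sub>m U' = U - U'" using that by auto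
    ultimately show ?thesis by simp
  qed
  have combine: "P S U"
    if comb: "S \<in> carrier_mat n n" "U \<in> carrier_mat n n" "coprime c d"
      "P (c \<cdot>\<^sub>m S) (c \<cdot>\<^sub>m U)" "P (d \<cdot>\<^sub>m S) (d \<cdot>\<^sub>m U)" for S U c d
  proof -
    obtain r s where rs: "r * c + s * d = 1"
      using bezout_int[of c d] comb(3) by (metis (no_types) coprime_iff_gcd_eq_1)
    have "P (r \<cdot>\<^sub>m (c \<cdot>\<^sub>m S) + s \<cdot>\<^sub>m (d \<cdot>\<^sub>m S)) (r \<cdot>\<^sub>m (c \<cdot>\<^sub>m U) + s \<cdot>\<^sub>m (d \<cdot>\<^sub>m U))"
      using comb(1,2) by (intro add smult[OF _ _ comb(4)] smult[OF _ _ comb(5)]) auto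
    moreover have "r \<cdot>\<^sub>m (c \<cdot>\<^sub>m Z) + s \<cdot>\<^sub>m (d \<cdot>\<^sub>m Z) = Z" if "Z \<in> carrier_mat n n" for Z :: "int mat"
    proof -
      have "r \<cdot>\<^sub>m (c \<cdot>\<^sub>m Z) + s \<cdot>\<^sub>m (d \<cdot>\<^sub>m Z) = (r * c + s * d) \<cdot>\<^sub>m Z"
        using that by (intro eq_matI) (auto simp: algebra_simps)
      then show ?thesis unfolding rs using that by (simp add: mat_eq_iff)
    qed
    ultimately show ?thesis using comb by simp
  qed
  have multiple: "P (t \<cdot>\<^sub>m S) (t \<cdot>\<^sub>m U)"
    if SU: "S \<in> carrier_mat n n" "U \<in> carrier_mat n n" "mat_trace S = mat_trace U" for S U
  proof -
    obtain Y0 Y1 Y2 where Y: "Y0 \<in> carrier_mat n n" "Y1 \<in> carrier_mat n n" "Y2 \<in> carrier_mat n n"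
      and eq: "S = Y0 + ?N * Y1 + ?e * Y2" "U = Y0 + Y1 * ?N + Y2 * ?e"
      using equal_trace_decomposition[OF SU] by blast
    have "P (a1 \<cdot>\<^sub>m ((a5 * a6) \<cdot>\<^sub>m Y0) + a5 \<cdot>\<^sub>m (?N * ((a1 * a6) \<cdot>\<^sub>m Y1)) + a6 \<cdot>\<^sub>m (?e * ((a1 * a5) \<cdot>\<^sub>m Y2)))
      (a1 \<cdot>\<^sub>m ((a5 * a6) \<cdot>\<^sub>m Y0) + a5 \<cdot>\<^sub>m ((a1 * a6) \<cdot>\<^sub>m Y1 * ?N) + a6 \<cdot>\<^sub>m ((a1 * a5) \<cdot>\<^sub>m Y2 * ?e))"
      using Y by (intro add P1 P5 P6) (simp_all add: square_carrier)
    moreover have "a1 \<cdot>\<^sub>m ((a5 * a6) \<cdot>\<^sub>m Y0) + a5 \<cdot>\<^sub>m (?N * ((a1 * a6) \<cdot>\<^sub>m Y1)) + a6 \<cdot>\<^sub>m (?e * ((a1 * a5) \<cdot>\<^sub>m Y2)) = t \<cdot>\<^sub>m S"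
      using Y unfolding eq t_def
      by (intro eq_matI) (simp_all add: square_ring algebra_simps del: index_mult_mat(1))
    moreover have "a1 \<cdot>\<^sub>m ((a5 * a6) \<cdot>\<^sub>m Y0) + a5 \<cdot>\<^sub>m ((a1 * a6) \<cdot>\<^sub>m Y1 * ?N) + a6 \<cdot>\<^sub>m ((a1 * a5) \<cdot>\<^sub>m Y2 * ?e) = t \<cdot>\<^sub>m U"
      using Y unfolding eq t_def
      by (intro eq_matI) (simp_all add: square_ring algebra_simps del: index_mult_mat(1))
    ultimately show ?thesis by simp
  qed
  \<comment> \<open>The terms with \<open>K\<close>, \<open>g\<close> and \<open>h\<close> form
    \<open>t\<close> times a pair whose traces agree by cyclicity, so \<open>multiple\<close>
    subtracts them.\<close>
  have PQ: "P ((b * a5 * a6) \<cdot>\<^sub>m W + (b * a1 * a6) \<cdot>\<^sub>m (?N * W) + (b * a1 * a5) \<cdot>\<^sub>m (?e * W))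
      ((b * a5 * a6) \<cdot>\<^sub>m W + (b * a1 * a6) \<cdot>\<^sub>m (W * ?N) + (b * a1 * a5) \<cdot>\<^sub>m (W * ?e))"
    if W: "W \<in> carrier_mat n n" for W
  proof -
    let ?S = "b \<cdot>\<^sub>m (K * W - g * (h * W))" and ?U = "b \<cdot>\<^sub>m (W * K - h * W * g)"
    have cS: "?S \<in> carrier_mat n n" and cU: "?U \<in> carrier_mat n n"
      and cq: "q \<in> carrier_mat n n"
      using W car by (simp_all add: square_carrier q)
    have "mat_trace ?S = mat_trace ?U"
      using W car mat_trace_comm[of K n W] mat_trace_comm[of g n "h * W"]
      by (simp add: square_trace square_carrier)
    then have "P (t \<cdot>\<^sub>m ?S) (t \<cdot>\<^sub>m ?U)" using cS cU by (intro multiple)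
    then have "P (b \<cdot>\<^sub>m (q * W - t \<cdot>\<^sub>m (g * (h * W))) - t \<cdot>\<^sub>m ?S) (b \<cdot>\<^sub>m (W * q - t \<cdot>\<^sub>m (h * W * g)) - t \<cdot>\<^sub>m ?U)"
      using W car cq cS cU by (intro diff PW) (simp_all add: square_carrier)
    moreover have "b \<cdot>\<^sub>m (q * W - t \<cdot>\<^sub>m (g * (h * W))) - t \<cdot>\<^sub>m ?S
        = (b * a5 * a6) \<cdot>\<^sub>m W + (b * a1 * a6) \<cdot>\<^sub>m (?N * W) + (b * a1 * a5) \<cdot>\<^sub>m (?e * W)"
      using W car unfolding q
      by (intro eq_matI) (simp_all add: square_ring algebra_simps del: index_mult_mat(1))
    moreover have "b \<cdot>\<^sub>m (W * q - t \<cdot>\<^sub>m (h * W * g)) - t \<cdot>\<^sub>m ?U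
        = (b * a5 * a6) \<cdot>\<^sub>m W + (b * a1 * a6) \<cdot>\<^sub>m (W * ?N) + (b * a1 * a5) \<cdot>\<^sub>m (W * ?e)"
      using W car unfolding q
      by (intro eq_matI) (simp_all add: square_ring algebra_simps del: index_mult_mat(1))
    ultimately show ?thesis by simp
  qed
  have I: "P Y Y" if Y: "Y \<in> carrier_mat n n" for Y
  proof -
    \<comment> \<open>This scaling makes the shift term divisible by \<open>a5\<close> and the
      corner term divisible by \<open>a6\<close>, so that \<open>P5\<close> and \<open>P6\<close>
      remove them.\<close>
    define W where "W = (a5 * a6) \<cdot>\<^sub>m Y"
    have W: "W \<in> carrier_mat n n" using Y by (simp add: W_def)
    have "P (((b * a5 * a6) \<cdot>\<^sub>m W + (b * a1 * a6) \<cdot>\<^sub>m (?N * W) + (b * a1 * a5) \<cdot>\<^sub>m (?e * W))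
        - (a5 \<cdot>\<^sub>m (?N * ((b * a1 * a6\<^sup>2) \<cdot>\<^sub>m Y)) + a6 \<cdot>\<^sub>m (?e * ((b * a1 * a5\<^sup>2) \<cdot>\<^sub>m Y))))
      (((b * a5 * a6) \<cdot>\<^sub>m W + (b * a1 * a6) \<cdot>\<^sub>m (W * ?N) + (b * a1 * a5) \<cdot>\<^sub>m (W * ?e))
        - (a5 \<cdot>\<^sub>m ((b * a1 * a6\<^sup>2) \<cdot>\<^sub>m Y * ?N) + a6 \<cdot>\<^sub>m ((b * a1 * a5\<^sup>2) \<cdot>\<^sub>m Y * ?e)))"
      using Y W by (intro diff add PQ P5 P6) (simp_all add: square_carrier)
    moreover have "((b * a5 * a6) \<cdot>\<^sub>m W + (b * a1 * a6) \<cdot>\<^sub>m (?N * W) + (b * a1 * a5) \<cdot>\<^sub>m (?e * W))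
        - (a5 \<cdot>\<^sub>m (?N * ((b * a1 * a6\<^sup>2) \<cdot>\<^sub>m Y)) + a6 \<cdot>\<^sub>m (?e * ((b * a1 * a5\<^sup>2) \<cdot>\<^sub>m Y)))
        = (b * a5\<^sup>2 * a6\<^sup>2) \<cdot>\<^sub>m Y"
      using Y unfolding W_def
      by (intro eq_matI) (simp_all add: square_ring algebra_simps power2_eq_square del: index_mult_mat(1))
    moreover have "((b * a5 * a6) \<cdot>\<^sub>m W + (b * a1 * a6) \<cdot>\<^sub>m (W * ?N) + (b * a1 * a5) \<cdot>\<^sub>m (W * ?e))
        - (a5 \<cdot>\<^sub>m ((b * a1 * a6\<^sup>2) \<cdot>\<^sub>m Y * ?N) + a6 \<cdot>\<^sub>m ((b * a1 * a5\<^sup>2) \<cdot>\<^sub>m Y * ?e))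
        = (b * a5\<^sup>2 * a6\<^sup>2) \<cdot>\<^sub>m Y"
      using Y unfolding W_def
      by (intro eq_matI) (simp_all add: square_ring algebra_simps power2_eq_square del: index_mult_mat(1))
    ultimately have "P ((b * a5\<^sup>2 * a6\<^sup>2) \<cdot>\<^sub>m Y) ((b * a5\<^sup>2 * a6\<^sup>2) \<cdot>\<^sub>m Y)" by simp
    moreover have "coprime a1 (b * a5\<^sup>2 * a6\<^sup>2)" using cop by simp
    ultimately show ?thesis using Y P1 by (intro combine[of Y Y a1]) auto
  qed
  have J: "P (?N * Y) (Y * ?N)" if Y: "Y \<in> carrier_mat n n" for Y
  proof -
    \<comment> \<open>The identity term can now be removed by \<open>I\<close> without any
      divisibility; only the corner term needs a factor \<open>a6\<close>.\<close>
    define W where "W = a6 \<cdot>\<^sub>m Y"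
    have W: "W \<in> carrier_mat n n" using Y by (simp add: W_def)
    have "P (((b * a5 * a6) \<cdot>\<^sub>m W + (b * a1 * a6) \<cdot>\<^sub>m (?N * W) + (b * a1 * a5) \<cdot>\<^sub>m (?e * W))
        - ((b * a5 * a6\<^sup>2) \<cdot>\<^sub>m Y + a6 \<cdot>\<^sub>m (?e * ((b * a1 * a5) \<cdot>\<^sub>m Y))))
      (((b * a5 * a6) \<cdot>\<^sub>m W + (b * a1 * a6) \<cdot>\<^sub>m (W * ?N) + (b * a1 * a5) \<cdot>\<^sub>m (W * ?e))
        - ((b * a5 * a6\<^sup>2) \<cdot>\<^sub>m Y + a6 \<cdot>\<^sub>m ((b * a1 * a5) \<cdot>\<^sub>m Y * ?e)))"
      using Y W by (intro diff add PQ I P6) (simp_all add: square_carrier)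
    moreover have "((b * a5 * a6) \<cdot>\<^sub>m W + (b * a1 * a6) \<cdot>\<^sub>m (?N * W) + (b * a1 * a5) \<cdot>\<^sub>m (?e * W))
        - ((b * a5 * a6\<^sup>2) \<cdot>\<^sub>m Y + a6 \<cdot>\<^sub>m (?e * ((b * a1 * a5) \<cdot>\<^sub>m Y)))
        = (b * a1 * a6\<^sup>2) \<cdot>\<^sub>m (?N * Y)"
      using Y unfolding W_def
      by (intro eq_matI) (simp_all add: square_ring algebra_simps power2_eq_square del: index_mult_mat(1))
    moreover have "((b * a5 * a6) \<cdot>\<^sub>m W + (b * a1 * a6) \<cdot>\<^sub>m (W * ?N) + (b * a1 * a5) \<cdot>\<^sub>m (W * ?e))
        - ((b * a5 * a6\<^sup>2) \<cdot>\<^sub>m Y + a6 \<cdot>\<^sub>m ((b * a1 * a5) \<cdot>\<^sub>m Y * ?e))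
        = (b * a1 * a6\<^sup>2) \<cdot>\<^sub>m (Y * ?N)"
      using Y unfolding W_def
      by (intro eq_matI) (simp_all add: square_ring algebra_simps power2_eq_square del: index_mult_mat(1))
    ultimately have "P ((b * a1 * a6\<^sup>2) \<cdot>\<^sub>m (?N * Y)) ((b * a1 * a6\<^sup>2) \<cdot>\<^sub>m (Y * ?N))" by simp
    moreover have "coprime a5 (b * a1 * a6\<^sup>2)" using cop by (simp add: coprime_commute)
    ultimately show ?thesis using Y P5
      by (intro combine[of "?N * Y" "Y * ?N" a5]) (auto simp: square_carrier)
  qed
  have L: "P (?e * Y) (Y * ?e)" if Y: "Y \<in> carrier_mat n n" for Y
  proof -
    have "P (((b * a5 * a6) \<cdot>\<^sub>m Y + (b * a1 * a6) \<cdot>\<^sub>m (?N * Y) + (b * a1 * a5) \<cdot>\<^sub>m (?e * Y))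
        - ((b * a5 * a6) \<cdot>\<^sub>m Y + (b * a1 * a6) \<cdot>\<^sub>m (?N * Y)))
      (((b * a5 * a6) \<cdot>\<^sub>m Y + (b * a1 * a6) \<cdot>\<^sub>m (Y * ?N) + (b * a1 * a5) \<cdot>\<^sub>m (Y * ?e))
        - ((b * a5 * a6) \<cdot>\<^sub>m Y + (b * a1 * a6) \<cdot>\<^sub>m (Y * ?N)))"
      using Y by (intro diff add PQ smult I J) (simp_all add: square_carrier)
    moreover have "((b * a5 * a6) \<cdot>\<^sub>m Y + (b * a1 * a6) \<cdot>\<^sub>m (?N * Y) + (b * a1 * a5) \<cdot>\<^sub>m (?e * Y))
        - ((b * a5 * a6) \<cdot>\<^sub>m Y + (b * a1 * a6) \<cdot>\<^sub>m (?N * Y)) = (b * a1 * a5) \<cdot>\<^sub>m (?e * Y)"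
      using Y by (intro eq_matI) (simp_all add: square_ring del: index_mult_mat(1))
    moreover have "((b * a5 * a6) \<cdot>\<^sub>m Y + (b * a1 * a6) \<cdot>\<^sub>m (Y * ?N) + (b * a1 * a5) \<cdot>\<^sub>m (Y * ?e))
        - ((b * a5 * a6) \<cdot>\<^sub>m Y + (b * a1 * a6) \<cdot>\<^sub>m (Y * ?N)) = (b * a1 * a5) \<cdot>\<^sub>m (Y * ?e)"
      using Y by (intro eq_matI) (simp_all add: square_ring del: index_mult_mat(1))
    ultimately have "P ((b * a1 * a5) \<cdot>\<^sub>m (?e * Y)) ((b * a1 * a5) \<cdot>\<^sub>m (Y * ?e))" by simp
    moreover have "coprime a6 (b * a1 * a5)" using cop by (simp add: coprime_commute)
    ultimately show ?thesis using Y P6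
      by (intro combine[of "?e * Y" "Y * ?e" a6]) (auto simp: square_carrier)
  qed
  obtain Y0 Y1 Y2 where Y: "Y0 \<in> carrier_mat n n" "Y1 \<in> carrier_mat n n" "Y2 \<in> carrier_mat n n"
    and eq: "S = Y0 + ?N * Y1 + ?e * Y2" "U = Y0 + Y1 * ?N + Y2 * ?e"
    using equal_trace_decomposition[OF S U tr] by blast
  show ?thesis unfolding eq using Y by (intro add I J L) (simp_all add: square_carrier)
qed

section \<open>Squares of block matrices and the representation by six squares\<close>

lemma block_square:
  assumes "P \<in> carrier_mat n n" "Q \<in> carrier_mat n n" "R \<in> carrier_mat n n" "S \<in> carrier_mat n n"
  shows "four_block_mat P Q R S ^\<^sub>m 2 =
    four_block_mat (P * P + Q * R) (P * Q + Q * S) (R * P + S * R) (R * Q + (S * S :: int mat))"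
proof -
  have "four_block_mat P Q R S ^\<^sub>m 2 = four_block_mat P Q R S * four_block_mat P Q R S"
    using assms by (simp add: numeral_2_eq_2 left_mult_one_mat[of _ "n + n" "n + n"])
  then show ?thesis using assms by (simp add: mult_four_block_mat[of _ n n _ n _ n])
qed

lemma block_smult:
  assumes "P \<in> carrier_mat n n" "Q \<in> carrier_mat n n" "R \<in> carrier_mat n n" "S \<in> carrier_mat n n"
  shows "(c :: int) \<cdot>\<^sub>m four_block_mat P Q R S =
    four_block_mat (c \<cdot>\<^sub>m P) (c \<cdot>\<^sub>m Q) (c \<cdot>\<^sub>m R) (c \<cdot>\<^sub>m S)"
  using assms by (rule smult_four_block_mat)

lemma block_add:
  assumes "P \<in> carrier_mat n n" "Q \<in> carrier_mat n n" "R \<in> carrier_mat n n" "S \<in> carrier_mat n n"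
    "P' \<in> carrier_mat n n" "Q' \<in> carrier_mat n n" "R' \<in> carrier_mat n n" "S' \<in> carrier_mat n n"
  shows "four_block_mat P Q R S + four_block_mat P' Q' R' S' =
    four_block_mat (P + P') (Q + Q') (R + R') (S + (S' :: int mat))"
  using assms by (rule add_four_block_mat)

lemma block_carrier:
  "P \<in> carrier_mat n n \<Longrightarrow> S \<in> carrier_mat n n \<Longrightarrow> four_block_mat P Q R S \<in> carrier_mat (n + n) (n + n)"
  by (rule four_block_carrier_mat)

text \<open>\<open>q3\<close> and \<open>q4\<close> match the upper right block, \<open>R3\<close> and \<open>R4\<close> the lower left one up to the free parameter
  \<open>W\<close>, and \<open>u\<close>, \<open>w\<close>, \<open>x\<close> the difference of the traces of the diagonal blocks.\<close>

lemma six_square_representation: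
  fixes a1 a2 a3 a4 a5 a6 :: int
  assumes n: "n > 0"
    and cop: "coprime a1 a3" "coprime a1 a4" "coprime a1 a5" "coprime a1 a6" "coprime a2 a3"
      "coprime a3 a4" "coprime a3 a5" "coprime a3 a6" "coprime a4 a5" "coprime a4 a6" "coprime a5 a6"
    and odd: "odd a2" "odd a3"
    and A: "A \<in> carrier_mat (n + n) (n + n)"
  obtains X1 X2 X3 X4 X5 X6 where
    "X1 \<in> carrier_mat (n + n) (n + n)" "X2 \<in> carrier_mat (n + n) (n + n)"
    "X3 \<in> carrier_mat (n + n) (n + n)" "X4 \<in> carrier_mat (n + n) (n + n)"
    "X5 \<in> carrier_mat (n + n) (n + n)" "X6 \<in> carrier_mat (n + n) (n + n)"
    "A = a1 \<cdot>\<^sub>m X1 ^\<^sub>m 2 + a2 \<cdot>\<^sub>m X2 ^\<^sub>m 2 + a3 \<cdot>\<^sub>m X3 ^\<^sub>m 2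
      + a4 \<cdot>\<^sub>m X4 ^\<^sub>m 2 + a5 \<cdot>\<^sub>m X5 ^\<^sub>m 2 + a6 \<cdot>\<^sub>m X6 ^\<^sub>m 2"
proof -
  let ?N = "shift_mat n" and ?e = "corner_mat n" and ?I = "1\<^sub>m n :: int mat" and ?O = "0\<^sub>m n n :: int mat"
  obtain A11 A12 A21 A22 where split: "split_block A n n = (A11, A12, A21, A22)"
    by (metis prod_cases4)
  have cA: "A11 \<in> carrier_mat n n" "A12 \<in> carrier_mat n n" "A21 \<in> carrier_mat n n" "A22 \<in> carrier_mat n n"
    and A_eq: "A = four_block_mat A11 A12 A21 A22"
    using split_block[OF split] A by auto
  obtain V V' where V: "V \<in> carrier_mat n n" "V' \<in> carrier_mat n n" "V * V' = 1\<^sub>m n" "V' * V = 1\<^sub>m n"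
    and trV: "mat_trace V = 1"
    using unimodular_trace_one[OF n] by blast
  \<comment> \<open>\<open>t\<close> will be the scalar in the upper left block of
    \<open>X4\<close>. It puts a factor \<open>t\<close> on the effect that \<open>W\<close> has
    through \<open>X3\<close>, which is thus absorbed in the lattice argument.\<close>
  define t where "t = a1 * a5 * a6"
  have VV'Z: "V * (V' * Z) = Z" if "Z \<in> carrier_mat n n" for Z
    using assoc_mult_mat[of V n n V' n Z n] V that by simp
  \<comment> \<open>\<alpha> and \<beta> solve the upper right block, where \<open>q4\<close> may
    vary only by multiples of \<open>t\<close>, hence the square. \<gamma> and \<delta> solve the
    lower left block, where \<open>R4\<close> is unrestricted.\<close>
  obtain \<alpha> \<beta> where \<alpha>\<beta>: "\<alpha> * a3 + \<beta> * (a4 * t\<^sup>2) = 1"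
  proof -
    have "coprime a3 (a4 * t\<^sup>2)" using cop by (simp add: t_def coprime_commute)
    then show ?thesis using that bezout_int[of a3 "a4 * t\<^sup>2"] by (metis coprime_iff_gcd_eq_1)
  qed
  obtain \<gamma> \<delta> where \<gamma>\<delta>: "\<gamma> * a3 + \<delta> * (a4 * t) = 1"
  proof -
    have "coprime a3 (a4 * t)" using cop by (simp add: t_def coprime_commute)
    then show ?thesis using that bezout_int[of a3 "a4 * t"] by (metis coprime_iff_gcd_eq_1)
  qed
  \<comment> \<open>To the trace difference of the diagonal blocks, \<open>X2\<close> contributes
    \<open>a2 * (u\<^sup>2 - w\<^sup>2)\<close>, \<open>X3\<close> contributes
    \<open>a3 * (2 * x - mat_trace (V * V))\<close> and \<open>X4\<close> contributes
    \<open>a4 * (int n * t\<^sup>2)\<close>; products of off-diagonal blocks contribute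
    nothing.\<close>
  obtain u w x where uwx: "mat_trace A11 - mat_trace A22 + a3 * mat_trace (V * V) - a4 * (int n * t\<^sup>2)
      = a2 * (u\<^sup>2 - w\<^sup>2) + 2 * a3 * x"
    using odd_coprime_trace_equation[OF cop(5) odd] by blast
  define q0 where "q0 = (a5 * a6) \<cdot>\<^sub>m ?I + (a1 * a6) \<cdot>\<^sub>m ?N + (a1 * a5) \<cdot>\<^sub>m ?e"
  define B where "B = A12 - (a4 * t) \<cdot>\<^sub>m q0"
  define K where "K = \<beta> \<cdot>\<^sub>m B"
  define q4 where "q4 = q0 + t \<cdot>\<^sub>m K"
  define q3 where "q3 = \<alpha> \<cdot>\<^sub>m (B * V')"
  have cq: "q0 \<in> carrier_mat n n" "B \<in> carrier_mat n n" "K \<in> carrier_mat n n"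
    "q4 \<in> carrier_mat n n" "q3 \<in> carrier_mat n n"
    using V cA by (simp_all add: q0_def B_def K_def q4_def q3_def square_carrier)
  \<comment> \<open>The pairs that the free blocks \<open>R1\<close>, \<open>R5\<close>,
    \<open>R6\<close> and \<open>W\<close> add to the two diagonal blocks.\<close>
  define P where "P = (\<lambda>S U. \<exists>R1 \<in> carrier_mat n n. \<exists>R5 \<in> carrier_mat n n. \<exists>R6 \<in> carrier_mat n n.
      \<exists>W \<in> carrier_mat n n.
      S = a1 \<cdot>\<^sub>m R1 + a5 \<cdot>\<^sub>m (?N * R5) + a6 \<cdot>\<^sub>m (?e * R6) + (a3 * a4) \<cdot>\<^sub>m (q4 * W - t \<cdot>\<^sub>m (q3 * (V' * W))) \<and>
      U = a1 \<cdot>\<^sub>m R1 + a5 \<cdot>\<^sub>m (R5 * ?N) + a6 \<cdot>\<^sub>m (R6 * ?e) + (a3 * a4) \<cdot>\<^sub>m (W * q4 - t \<cdot>\<^sub>m (V' * W * q3)))"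
  have PI: "P S U" if "R1 \<in> carrier_mat n n" "R5 \<in> carrier_mat n n" "R6 \<in> carrier_mat n n" "W \<in> carrier_mat n n"
    "S = a1 \<cdot>\<^sub>m R1 + a5 \<cdot>\<^sub>m (?N * R5) + a6 \<cdot>\<^sub>m (?e * R6) + (a3 * a4) \<cdot>\<^sub>m (q4 * W - t \<cdot>\<^sub>m (q3 * (V' * W)))"
    "U = a1 \<cdot>\<^sub>m R1 + a5 \<cdot>\<^sub>m (R5 * ?N) + a6 \<cdot>\<^sub>m (R6 * ?e) + (a3 * a4) \<cdot>\<^sub>m (W * q4 - t \<cdot>\<^sub>m (V' * W * q3))"
    for R1 R5 R6 W S U
    unfolding P_def using that by blast
  have P_full: "P S U" if "S \<in> carrier_mat n n" "U \<in> carrier_mat n n" "mat_trace S = mat_trace U" for S U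
  \<comment> \<open>The parameters enter linearly, which gives closure; each generator arises by
    setting all parameters but one to zero.\<close>
  proof (rule equal_trace_lattice[where ?a1.0 = a1 and ?a5.0 = a5 and ?a6.0 = a6 and b = "a3 * a4"
        and q = q4 and K = K and g = q3 and h = V', folded t_def], goal_cases)
    case (1 S U S' U')
    from 1(5) obtain R1 R5 R6 W where R: "R1 \<in> carrier_mat n n" "R5 \<in> carrier_mat n n"
      "R6 \<in> carrier_mat n n" "W \<in> carrier_mat n n"
      and eq: "S = a1 \<cdot>\<^sub>m R1 + a5 \<cdot>\<^sub>m (?N * R5) + a6 \<cdot>\<^sub>m (?e * R6) + (a3 * a4) \<cdot>\<^sub>m (q4 * W - t \<cdot>\<^sub>m (q3 * (V' * W)))"
      "U = a1 \<cdot>\<^sub>m R1 + a5 \<cdot>\<^sub>m (R5 * ?N) + a6 \<cdot>\<^sub>m (R6 * ?e) + (a3 * a4) \<cdot>\<^sub>m (W * q4 - t \<cdot>\<^sub>m (V' * W * q3))"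
      unfolding P_def by blast
    from 1(6) obtain R1' R5' R6' W' where R': "R1' \<in> carrier_mat n n" "R5' \<in> carrier_mat n n"
      "R6' \<in> carrier_mat n n" "W' \<in> carrier_mat n n"
      and eq': "S' = a1 \<cdot>\<^sub>m R1' + a5 \<cdot>\<^sub>m (?N * R5') + a6 \<cdot>\<^sub>m (?e * R6') + (a3 * a4) \<cdot>\<^sub>m (q4 * W' - t \<cdot>\<^sub>m (q3 * (V' * W')))"
      "U' = a1 \<cdot>\<^sub>m R1' + a5 \<cdot>\<^sub>m (R5' * ?N) + a6 \<cdot>\<^sub>m (R6' * ?e) + (a3 * a4) \<cdot>\<^sub>m (W' * q4 - t \<cdot>\<^sub>m (V' * W' * q3))"
      unfolding P_def by blast
    show ?case
    proof (rule PI[of "R1 + R1'" "R5 + R5'" "R6 + R6'" "W + W'"], goal_cases)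
      case 5
      show ?case unfolding eq eq' using R R' V cq
        by (intro eq_matI) (simp_all add: square_ring algebra_simps del: index_mult_mat(1))
    next
      case 6
      show ?case unfolding eq eq' using R R' V cq
        by (intro eq_matI) (simp_all add: square_ring algebra_simps del: index_mult_mat(1))
    qed (use R R' in simp_all)
  next
    case (2 c S U)
    from 2(3) obtain R1 R5 R6 W where R: "R1 \<in> carrier_mat n n" "R5 \<in> carrier_mat n n"
      "R6 \<in> carrier_mat n n" "W \<in> carrier_mat n n"
      and eq: "S = a1 \<cdot>\<^sub>m R1 + a5 \<cdot>\<^sub>m (?N * R5) + a6 \<cdot>\<^sub>m (?e * R6) + (a3 * a4) \<cdot>\<^sub>m (q4 * W - t \<cdot>\<^sub>m (q3 * (V' * W)))"
      "U = a1 \<cdot>\<^sub>m R1 + a5 \<cdot>\<^sub>m (R5 * ?N) + a6 \<cdot>\<^sub>m (R6 * ?e) + (a3 * a4) \<cdot>\<^sub>m (W * q4 - t \<cdot>\<^sub>m (V' * W * q3))"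
      unfolding P_def by blast
    show ?case
    proof (rule PI[of "c \<cdot>\<^sub>m R1" "c \<cdot>\<^sub>m R5" "c \<cdot>\<^sub>m R6" "c \<cdot>\<^sub>m W"], goal_cases)
      case 5
      show ?case unfolding eq using R V cq
        by (intro eq_matI) (simp_all add: square_ring algebra_simps del: index_mult_mat(1))
    next
      case 6
      show ?case unfolding eq using R V cq
        by (intro eq_matI) (simp_all add: square_ring algebra_simps del: index_mult_mat(1))
    qed (use R in simp_all)
  next
    case (3 Y)
    show ?case by (rule PI[of Y ?O ?O ?O]) (use 3 V cq in \<open>auto simp: square_carrier\<close>)
  next
    case (4 Y)
    show ?case by (rule PI[of ?O Y ?O ?O]) (use 4 V cq in \<open>auto simp: square_carrier\<close>)
  next
    case (5 Y)
    show ?case by (rule PI[of ?O ?O Y ?O]) (use 5 V cq in \<open>auto simp: square_carrier\<close>)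
  next
    case (6 W)
    show ?case by (rule PI[of ?O ?O ?O W]) (use 6 V cq in \<open>auto simp: square_carrier\<close>)
  next
    case 7
    show ?case by (simp add: q4_def q0_def)
  qed (use that cq V cop in \<open>auto simp: coprime_commute\<close>)
  \<comment> \<open>\<open>S0\<close> and \<open>U0\<close> are what the free blocks must still
    supply on the diagonal once \<open>X2\<close> and the values of \<open>X3\<close> and
    \<open>X4\<close> at \<open>W = 0\<close> are subtracted.\<close>
  define S0 where "S0 = A11 - (a2 * u\<^sup>2) \<cdot>\<^sub>m ?e - a3 \<cdot>\<^sub>m (x\<^sup>2 \<cdot>\<^sub>m ?I + \<gamma> \<cdot>\<^sub>m (q3 * (V' * A21)))
    - a4 \<cdot>\<^sub>m (t\<^sup>2 \<cdot>\<^sub>m ?I + \<delta> \<cdot>\<^sub>m (q4 * A21))"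
  define U0 where "U0 = A22 - (a2 * w\<^sup>2) \<cdot>\<^sub>m ?e - a3 \<cdot>\<^sub>m (\<gamma> \<cdot>\<^sub>m (V' * A21 * q3) + (V - x \<cdot>\<^sub>m ?I) * (V - x \<cdot>\<^sub>m ?I))
    - a4 \<cdot>\<^sub>m (\<delta> \<cdot>\<^sub>m (A21 * q4))"
  have ee: "?e * ?e = ?e"
  proof (intro eq_matI, goal_cases)
    case (1 i j)
    then show ?case
      using corner_mult_index[OF corner_mat_carrier, of i n j] by (auto simp: corner_mat_def)
  qed simp_all
  have tre: "mat_trace ?e = 1"
  proof -
    have "mat_trace ?e = (\<Sum>i<n. if i = n - 1 then 1 else 0)"
      unfolding mat_trace_def using n by (intro sum.cong) (auto simp: corner_mat_def)
    then show ?thesis using n by simp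
  qed
  have cS0: "S0 \<in> carrier_mat n n" "U0 \<in> carrier_mat n n"
    unfolding S0_def U0_def using cA V cq by (simp_all add: square_carrier)
  have "mat_trace S0 = mat_trace A11 - a2 * u\<^sup>2 - a3 * (x\<^sup>2 * int n + \<gamma> * mat_trace (q3 * (V' * A21)))
      - a4 * (t\<^sup>2 * int n + \<delta> * mat_trace (q4 * A21))"
    unfolding S0_def using cA V cq by (simp add: square_trace square_carrier tre)
  moreover have "mat_trace U0 = mat_trace A22 - a2 * w\<^sup>2
      - a3 * (\<gamma> * mat_trace (V' * A21 * q3) + (mat_trace (V * V) - x - x * (1 - x * int n)))
      - a4 * (\<delta> * mat_trace (A21 * q4))"
    unfolding U0_def using cA V cq
    by (simp add: square_ring square_trace tre trV del: assoc_mult_mat)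
  moreover have "mat_trace (q3 * (V' * A21)) = mat_trace (V' * A21 * q3)"
    "mat_trace (q4 * A21) = mat_trace (A21 * q4)"
    using cA V cq by (intro mat_trace_comm[of _ n]; simp add: square_carrier)+
  \<comment> \<open>The terms with \<open>x\<^sup>2 * int n\<close> cancel between the two
    blocks.\<close>
  ultimately have "mat_trace S0 = mat_trace U0"
    using uwx by (simp add: algebra_simps power2_eq_square)
  then have "P S0 U0" by (rule P_full[OF cS0])
  then obtain R1 R5 R6 W where R: "R1 \<in> carrier_mat n n" "R5 \<in> carrier_mat n n"
    "R6 \<in> carrier_mat n n" "W \<in> carrier_mat n n"
    and S0: "S0 = a1 \<cdot>\<^sub>m R1 + a5 \<cdot>\<^sub>m (?N * R5) + a6 \<cdot>\<^sub>m (?e * R6) + (a3 * a4) \<cdot>\<^sub>m (q4 * W - t \<cdot>\<^sub>m (q3 * (V' * W)))"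
    and U0: "U0 = a1 \<cdot>\<^sub>m R1 + a5 \<cdot>\<^sub>m (R5 * ?N) + a6 \<cdot>\<^sub>m (R6 * ?e) + (a3 * a4) \<cdot>\<^sub>m (W * q4 - t \<cdot>\<^sub>m (V' * W * q3))"
    unfolding P_def by blast
  \<comment> \<open>The two occurrences of \<open>W\<close> cancel in \<open>a3\<close> times
    \<open>V * R3\<close> plus \<open>a4 * t\<close> times \<open>R4\<close>, so \<open>W\<close>
    moves the diagonal blocks while the lower left one stays fixed.\<close>
  define R3 where "R3 = V' * (\<gamma> \<cdot>\<^sub>m A21 - (a4 * t) \<cdot>\<^sub>m W)"
  define R4 where "R4 = \<delta> \<cdot>\<^sub>m A21 + a3 \<cdot>\<^sub>m W"
  have cR: "R3 \<in> carrier_mat n n" "R4 \<in> carrier_mat n n"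
    unfolding R3_def R4_def using R V cA by (simp_all add: square_carrier)
  \<comment> \<open>With zero diagonal blocks, the squares of \<open>X1\<close>, \<open>X5\<close>
    and \<open>X6\<close> are block diagonal. In \<open>X2\<close> the corner unit is idempotent of
    trace 1, so the traces of the blocks of the square are \<open>u\<^sup>2\<close> and
    \<open>w\<^sup>2\<close>.\<close>
  define X1 where "X1 = four_block_mat ?O ?I R1 ?O"
  define X2 where "X2 = four_block_mat (u \<cdot>\<^sub>m ?e) ?O ?O (w \<cdot>\<^sub>m ?e)"
  define X3 where "X3 = four_block_mat (x \<cdot>\<^sub>m ?I) q3 R3 (V - x \<cdot>\<^sub>m ?I)"
  define X4 where "X4 = four_block_mat (t \<cdot>\<^sub>m ?I) q4 R4 ?O"
  define X5 where "X5 = four_block_mat ?O ?N R5 ?O"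
  define X6 where "X6 = four_block_mat ?O ?e R6 ?O"
  have sq1: "X1 ^\<^sub>m 2 = four_block_mat R1 ?O ?O R1"
    unfolding X1_def using R by (simp add: block_square)
  have sq2: "X2 ^\<^sub>m 2 = four_block_mat (u\<^sup>2 \<cdot>\<^sub>m ?e) ?O ?O (w\<^sup>2 \<cdot>\<^sub>m ?e)"
    unfolding X2_def by (simp add: block_square square_ring ee power2_eq_square)
      (intro cong_four_block_mat eq_matI; simp)
  have sq3: "X3 ^\<^sub>m 2 = four_block_mat (x\<^sup>2 \<cdot>\<^sub>m ?I + q3 * R3) (q3 * V) (V * R3)
      (R3 * q3 + (V - x \<cdot>\<^sub>m ?I) * (V - x \<cdot>\<^sub>m ?I))"
    unfolding X3_def using V cq cR
    by (simp add: block_square square_carrier)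
      (intro cong_four_block_mat eq_matI; simp add: square_ring power2_eq_square algebra_simps del: index_mult_mat(1))
  have sq4: "X4 ^\<^sub>m 2 = four_block_mat (t\<^sup>2 \<cdot>\<^sub>m ?I + q4 * R4) (t \<cdot>\<^sub>m q4) (t \<cdot>\<^sub>m R4) (R4 * q4)"
    unfolding X4_def using V cq cR
    by (simp add: block_square square_carrier)
      (intro cong_four_block_mat eq_matI; simp add: square_ring power2_eq_square algebra_simps del: index_mult_mat(1))
  have sq5: "X5 ^\<^sub>m 2 = four_block_mat (?N * R5) ?O ?O (R5 * ?N)"
    unfolding X5_def using R by (simp add: block_square square_carrier)
  have sq6: "X6 ^\<^sub>m 2 = four_block_mat (?e * R6) ?O ?O (R6 * ?e)"
    unfolding X6_def using R by (simp add: block_square square_carrier)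
  have sum: "a1 \<cdot>\<^sub>m X1 ^\<^sub>m 2 + a2 \<cdot>\<^sub>m X2 ^\<^sub>m 2 + a3 \<cdot>\<^sub>m X3 ^\<^sub>m 2
      + a4 \<cdot>\<^sub>m X4 ^\<^sub>m 2 + a5 \<cdot>\<^sub>m X5 ^\<^sub>m 2 + a6 \<cdot>\<^sub>m X6 ^\<^sub>m 2 =
    four_block_mat
      (a1 \<cdot>\<^sub>m R1 + a2 \<cdot>\<^sub>m (u\<^sup>2 \<cdot>\<^sub>m ?e) + a3 \<cdot>\<^sub>m (x\<^sup>2 \<cdot>\<^sub>m ?I + q3 * R3) + a4 \<cdot>\<^sub>m (t\<^sup>2 \<cdot>\<^sub>m ?I + q4 * R4)
        + a5 \<cdot>\<^sub>m (?N * R5) + a6 \<cdot>\<^sub>m (?e * R6))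
      (a3 \<cdot>\<^sub>m (q3 * V) + a4 \<cdot>\<^sub>m (t \<cdot>\<^sub>m q4))
      (a3 \<cdot>\<^sub>m (V * R3) + a4 \<cdot>\<^sub>m (t \<cdot>\<^sub>m R4))
      (a1 \<cdot>\<^sub>m R1 + a2 \<cdot>\<^sub>m (w\<^sup>2 \<cdot>\<^sub>m ?e) + a3 \<cdot>\<^sub>m (R3 * q3 + (V - x \<cdot>\<^sub>m ?I) * (V - x \<cdot>\<^sub>m ?I))
        + a4 \<cdot>\<^sub>m (R4 * q4) + a5 \<cdot>\<^sub>m (R5 * ?N) + a6 \<cdot>\<^sub>m (R6 * ?e))"
    unfolding sq1 sq2 sq3 sq4 sq5 sq6 using R cR V cq
    by (simp add: block_smult block_add square_carrier)
  have b11: "A11 = a1 \<cdot>\<^sub>m R1 + a2 \<cdot>\<^sub>m (u\<^sup>2 \<cdot>\<^sub>m ?e) + a3 \<cdot>\<^sub>m (x\<^sup>2 \<cdot>\<^sub>m ?I + q3 * R3) + a4 \<cdot>\<^sub>m (t\<^sup>2 \<cdot>\<^sub>m ?I + q4 * R4)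
        + a5 \<cdot>\<^sub>m (?N * R5) + a6 \<cdot>\<^sub>m (?e * R6)"
  proof -
    have "A11 = S0 + (a2 * u\<^sup>2) \<cdot>\<^sub>m ?e + a3 \<cdot>\<^sub>m (x\<^sup>2 \<cdot>\<^sub>m ?I + \<gamma> \<cdot>\<^sub>m (q3 * (V' * A21)))
      + a4 \<cdot>\<^sub>m (t\<^sup>2 \<cdot>\<^sub>m ?I + \<delta> \<cdot>\<^sub>m (q4 * A21))"
      unfolding S0_def using cA V cq by (intro eq_matI) (simp_all add: square_carrier del: index_mult_mat(1))
    also have "\<dots> = a1 \<cdot>\<^sub>m R1 + a2 \<cdot>\<^sub>m (u\<^sup>2 \<cdot>\<^sub>m ?e) + a3 \<cdot>\<^sub>m (x\<^sup>2 \<cdot>\<^sub>m ?I + q3 * R3) + a4 \<cdot>\<^sub>m (t\<^sup>2 \<cdot>\<^sub>m ?I + q4 * R4)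
        + a5 \<cdot>\<^sub>m (?N * R5) + a6 \<cdot>\<^sub>m (?e * R6)"
      unfolding S0 R3_def R4_def using cA V cq R
      by (intro eq_matI) (simp_all add: square_ring algebra_simps del: index_mult_mat(1))
    finally show ?thesis .
  qed
  have b22: "A22 = a1 \<cdot>\<^sub>m R1 + a2 \<cdot>\<^sub>m (w\<^sup>2 \<cdot>\<^sub>m ?e) + a3 \<cdot>\<^sub>m (R3 * q3 + (V - x \<cdot>\<^sub>m ?I) * (V - x \<cdot>\<^sub>m ?I))
        + a4 \<cdot>\<^sub>m (R4 * q4) + a5 \<cdot>\<^sub>m (R5 * ?N) + a6 \<cdot>\<^sub>m (R6 * ?e)"
  proof -
    \<comment> \<open>Naming this square keeps \<open>square_ring\<close> from expanding it.\<close>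
    define D where "D = (V - x \<cdot>\<^sub>m ?I) * (V - x \<cdot>\<^sub>m ?I)"
    have D: "D \<in> carrier_mat n n" unfolding D_def using V by (simp add: square_carrier)
    have "A22 = U0 + (a2 * w\<^sup>2) \<cdot>\<^sub>m ?e + a3 \<cdot>\<^sub>m (\<gamma> \<cdot>\<^sub>m (V' * A21 * q3) + D) + a4 \<cdot>\<^sub>m (\<delta> \<cdot>\<^sub>m (A21 * q4))"
      unfolding U0_def D_def[symmetric] using cA V cq D
      by (intro eq_matI) (simp_all add: square_carrier del: index_mult_mat(1))
    also have "\<dots> = a1 \<cdot>\<^sub>m R1 + a2 \<cdot>\<^sub>m (w\<^sup>2 \<cdot>\<^sub>m ?e) + a3 \<cdot>\<^sub>m (R3 * q3 + D)
        + a4 \<cdot>\<^sub>m (R4 * q4) + a5 \<cdot>\<^sub>m (R5 * ?N) + a6 \<cdot>\<^sub>m (R6 * ?e)"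
      unfolding U0 R3_def R4_def using cA V cq R D
      by (intro eq_matI) (simp_all add: square_ring algebra_simps del: index_mult_mat(1))
    finally show ?thesis unfolding D_def .
  qed
  have b12: "A12 = a3 \<cdot>\<^sub>m (q3 * V) + a4 \<cdot>\<^sub>m (t \<cdot>\<^sub>m q4)"
  proof -
    have "a3 \<cdot>\<^sub>m (q3 * V) + a4 \<cdot>\<^sub>m (t \<cdot>\<^sub>m q4) = (\<alpha> * a3 + \<beta> * (a4 * t\<^sup>2)) \<cdot>\<^sub>m B + (a4 * t) \<cdot>\<^sub>m q0"
      unfolding q3_def q4_def K_def using V cq
      by (intro eq_matI) (simp_all add: square_ring algebra_simps power2_eq_square del: index_mult_mat(1))
    also have "\<dots> = A12" unfolding \<alpha>\<beta> B_def using cA cq by (intro eq_matI) simp_all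
    finally show ?thesis by simp
  qed
  have b21: "A21 = a3 \<cdot>\<^sub>m (V * R3) + a4 \<cdot>\<^sub>m (t \<cdot>\<^sub>m R4)"
  proof -
    have "V * R3 = \<gamma> \<cdot>\<^sub>m A21 - (a4 * t) \<cdot>\<^sub>m W"
      unfolding R3_def using cA R by (simp add: VV'Z square_carrier)
    then have "a3 \<cdot>\<^sub>m (V * R3) + a4 \<cdot>\<^sub>m (t \<cdot>\<^sub>m R4) = (\<gamma> * a3 + \<delta> * (a4 * t)) \<cdot>\<^sub>m A21"
      unfolding R4_def using cA R by (intro eq_matI) (simp_all add: algebra_simps)
    also have "\<dots> = A21" unfolding \<gamma>\<delta> using cA by (simp add: mat_eq_iff)
    finally show ?thesis by simp
  qed
  show ?thesis
    by (rule that[of X1 X2 X3 X4 X5 X6])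
      (use V R in \<open>simp_all add: X1_def X2_def X3_def X4_def X5_def X6_def block_carrier square_carrier\<close>,
        use sum b11 b12 b21 b22 A_eq in \<open>simp add: X1_def X2_def X3_def X4_def X5_def X6_def\<close>)
qed

end

section \<open>From the block representation to universality\<close>

lemma diag_form_six:
  assumes "\<And>i. i \<in> {1..6} \<Longrightarrow> X i \<in> carrier_mat m m"
  shows "diag_form m 6 a X = a 1 \<cdot>\<^sub>m X 1 ^\<^sub>m 2 + a 2 \<cdot>\<^sub>m X 2 ^\<^sub>m 2 + a 3 \<cdot>\<^sub>m X 3 ^\<^sub>m 2
    + a 4 \<cdot>\<^sub>m X 4 ^\<^sub>m 2 + a 5 \<cdot>\<^sub>m X 5 ^\<^sub>m 2 + a 6 \<cdot>\<^sub>m X 6 ^\<^sub>m 2"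
proof -
  interpret ring "ring_mat TYPE(int) m ()" by (rule ring_mat)
  define f where "f = (\<lambda>i. a i \<cdot>\<^sub>m X i ^\<^sub>m 2)"
  have f: "f i \<in> carrier_mat m m" if "i \<in> {1..6}" for i
    unfolding f_def using assms[OF that] by (intro smult_carrier_mat pow_carrier_mat)
  have car: "f 1 \<in> carrier_mat m m" "f 2 \<in> carrier_mat m m" "f 3 \<in> carrier_mat m m"
    "f 4 \<in> carrier_mat m m" "f 5 \<in> carrier_mat m m" "f 6 \<in> carrier_mat m m"
    by (rule f; simp)+
  \<comment> \<open>In this order \<open>finsum\<close> unfolds to a right-nested sum that becomes
    the left-nested one by commuting at every level.\<close>
  have set: "{1..6} = {6, 5, 4, 3, 2, 1 :: nat}" by auto
  have "finsum (ring_mat TYPE(int) m ()) f {6, 5, 4, 3, 2, 1} = f 6 + (f 5 + (f 4 + (f 3 + (f 2 + f 1))))"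
    using car by (simp add: ring_mat_simps del: One_nat_def)
  also have "\<dots> = f 1 + f 2 + f 3 + f 4 + f 5 + f 6"
    using car by (simp add: comm_add_mat[of _ m m])
  finally show ?thesis unfolding diag_form_def set f_def .
qed

text \<open>At most one of six pairwise coprime integers is even, so after exchanging it with the first
  one the second and the third are odd.\<close>

lemma six_squares_universal:
  assumes n: "n > 0" and a: "pairwise_coprime 6 a"
  shows "universal_form (2 * n) 6 a"
  unfolding universal_form_def
proof
  fix A :: "int mat"
  assume "A \<in> carrier_mat (2 * n) (2 * n)"
  then have A: "A \<in> carrier_mat (n + n) (n + n)" by (simp add: mult_2)
  have cop: "coprime (a i) (a j)" if "i \<in> {1..6}" "j \<in> {1..6}" "i \<noteq> j" for i j
    using a that unfolding pairwise_coprime_def by blast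
  have odd_or: "odd (a i) \<or> odd (a j)" if "i \<in> {1..6}" "j \<in> {1..6}" "i \<noteq> j" for i j
    using cop[OF that] by (meson coprime_common_divisor odd_one)
  \<comment> \<open>Three indices suffice: if the first three coefficients are odd,
    \<open>k = 1\<close> is admissible wherever an even one may stand.\<close>
  obtain k :: nat where k: "k = 1 \<or> k = 2 \<or> k = 3"
    and odd: "k \<noteq> 1 \<Longrightarrow> odd (a 1)" "k \<noteq> 2 \<Longrightarrow> odd (a 2)" "k \<noteq> 3 \<Longrightarrow> odd (a 3)"
  proof -
    have "odd (a 1) \<or> odd (a 2)" "odd (a 1) \<or> odd (a 3)" "odd (a 2) \<or> odd (a 3)"
      by (rule odd_or; simp)+
    then consider "odd (a 2)" "odd (a 3)" "odd (a 1)" | "odd (a 2)" "odd (a 3)" "even (a 1)"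
      | "odd (a 1)" "odd (a 3)" | "odd (a 1)" "odd (a 2)" by blast
    then show ?thesis
      by cases (use that[of 1] that[of 2] that[of 3] in simp_all)
  qed
  define \<pi> where "\<pi> = Transposition.transpose 1 k"
  define b where "b = a \<circ> \<pi>"
  have \<pi>: "\<pi> i \<in> {1..6}" if "i \<in> {1..6}" for i
    using that k by (auto simp: \<pi>_def Transposition.transpose_def)
  have \<pi>_inj: "\<pi> i = \<pi> j \<longleftrightarrow> i = j" for i j
    unfolding \<pi>_def by (rule inj_eq[OF inj_transpose])
  have copb: "coprime (b i) (b j)" if "i \<in> {1..6}" "j \<in> {1..6}" "i \<noteq> j" for i j
    unfolding b_def comp_def using that by (intro cop \<pi>) (simp_all add: \<pi>_inj)
  have odd_b: "odd (b 2)" "odd (b 3)"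
    using k odd by (auto simp: b_def \<pi>_def Transposition.transpose_def)
  obtain X1 X2 X3 X4 X5 X6 where
    X: "X1 \<in> carrier_mat (n + n) (n + n)" "X2 \<in> carrier_mat (n + n) (n + n)"
      "X3 \<in> carrier_mat (n + n) (n + n)" "X4 \<in> carrier_mat (n + n) (n + n)"
      "X5 \<in> carrier_mat (n + n) (n + n)" "X6 \<in> carrier_mat (n + n) (n + n)"
    and A_eq: "A = b 1 \<cdot>\<^sub>m X1 ^\<^sub>m 2 + b 2 \<cdot>\<^sub>m X2 ^\<^sub>m 2 + b 3 \<cdot>\<^sub>m X3 ^\<^sub>m 2
      + b 4 \<cdot>\<^sub>m X4 ^\<^sub>m 2 + b 5 \<cdot>\<^sub>m X5 ^\<^sub>m 2 + b 6 \<cdot>\<^sub>m X6 ^\<^sub>m 2"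
    by (rule six_square_representation[OF n _ _ _ _ _ _ _ _ _ _ _ odd_b A, of "b 1" "b 4" "b 5" "b 6"];
        ((rule copb; simp) | (rule that; assumption)))
  define Y where "Y = (\<lambda>i :: nat. if i = 1 then X1 else if i = 2 then X2 else if i = 3 then X3
    else if i = 4 then X4 else if i = 5 then X5 else X6)"
  have Y: "Y i \<in> carrier_mat (n + n) (n + n)" for i using X by (simp add: Y_def)
  then have car: "c \<cdot>\<^sub>m Y i ^\<^sub>m 2 \<in> carrier_mat (n + n) (n + n)" for c i
    by (simp add: pow_carrier_mat)
  \<comment> \<open>\<pi> is an involution, so \<open>a i = b (\<pi> i)\<close> and the summands are
    only permuted.\<close>
  have "diag_form (n + n) 6 a (Y \<circ> \<pi>) = A"
  proof -
    have "diag_form (n + n) 6 a (Y \<circ> \<pi>) = a 1 \<cdot>\<^sub>m Y (\<pi> 1) ^\<^sub>m 2 + a 2 \<cdot>\<^sub>m Y (\<pi> 2) ^\<^sub>m 2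
      + a 3 \<cdot>\<^sub>m Y (\<pi> 3) ^\<^sub>m 2 + a 4 \<cdot>\<^sub>m Y (\<pi> 4) ^\<^sub>m 2 + a 5 \<cdot>\<^sub>m Y (\<pi> 5) ^\<^sub>m 2 + a 6 \<cdot>\<^sub>m Y (\<pi> 6) ^\<^sub>m 2"
      using Y by (subst diag_form_six) simp_all
    also have "\<dots> = b 1 \<cdot>\<^sub>m Y 1 ^\<^sub>m 2 + b 2 \<cdot>\<^sub>m Y 2 ^\<^sub>m 2 + b 3 \<cdot>\<^sub>m Y 3 ^\<^sub>m 2
      + b 4 \<cdot>\<^sub>m Y 4 ^\<^sub>m 2 + b 5 \<cdot>\<^sub>m Y 5 ^\<^sub>m 2 + b 6 \<cdot>\<^sub>m Y 6 ^\<^sub>m 2"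
    proof -
      from k consider "k = 1" | "k = 2" | "k = 3" by blast
      then show ?thesis
      proof cases
        case 1
        then show ?thesis by (simp add: b_def \<pi>_def Transposition.transpose_def)
      next
        case 2
        then show ?thesis
          using comm_add_mat[OF car[of "a 1" 2] car[of "a 2" 1]]
          by (simp add: b_def \<pi>_def Transposition.transpose_def)
      next
        case 3
        have "S + T + R = R + T + S" if "S \<in> carrier_mat (n + n) (n + n)"
          "T \<in> carrier_mat (n + n) (n + n)" "R \<in> carrier_mat (n + n) (n + n)" for S T R :: "int mat"
          using that by (intro eq_matI) simp_all
        from this[OF car[of "a 1" 3] car[of "a 2" 2] car[of "a 3" 1]] 3 show ?thesis
          by (simp add: b_def \<pi>_def Transposition.transpose_def)
      qed
    qed
    also have "\<dots> = A" unfolding A_eq by (simp add: Y_def)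
    finally show ?thesis .
  qed
  then show "\<exists>X. (\<forall>i \<in> {1..6}. X i \<in> carrier_mat (2 * n) (2 * n)) \<and> A = diag_form (2 * n) 6 a X"
    using Y by (intro exI[of _ "Y \<circ> \<pi>"]) (simp add: mult_2)
qed

theorem theorem3p4:
  fixes n :: nat
  assumes "n > 0"
  shows "min_universal (2 * n) \<le> 6 \<and>
    (\<forall>a :: nat \<Rightarrow> int. pairwise_coprime 6 a \<longrightarrow>
      (\<forall>A \<in> carrier_mat (2 * n) (2 * n). \<exists>X :: nat \<Rightarrow> int mat.
        (\<forall>i \<in> {1..6}. X i \<in> carrier_mat (2 * n) (2 * n)) \<and> A = diag_form (2 * n) 6 a X))"
proof
  show "min_universal (2 * n) \<le> 6"
    unfolding min_universal_def using six_squares_universal[OF assms] by (intro Least_le) simp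
  show "\<forall>a :: nat \<Rightarrow> int. pairwise_coprime 6 a \<longrightarrow>
      (\<forall>A \<in> carrier_mat (2 * n) (2 * n). \<exists>X :: nat \<Rightarrow> int mat.
        (\<forall>i \<in> {1..6}. X i \<in> carrier_mat (2 * n) (2 * n)) \<and> A = diag_form (2 * n) 6 a X)"
    using six_squares_universal[OF assms] unfolding universal_form_def by blast
qed

end
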